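(* Let $(t_n)_{n\ge 1}$ and $(w_n)_{n\ge 1}$ be sequences of positive real numbers such that $\sqrt{t_n}/w_n \to 0$ and $w_n/t_n\to 0$ as $n\to\infty$, and let $p:\mathbb{R}\to[0,1]$ be a weakly decreasing continuous function such that $p(c)\to 1$ as $c\to-\infty$ and $p(c)\to 0$ as $c\to+\infty$. Then there exists a sequence $((X^{(n)}_t)_{t\in\mathbb{R}_+})_{n\ge 1}$ of continuous time ergodic Markov chains on finite state spaces such that for every $c\in\mathbb{R}$, $$\mathrm{d}^{(n)}(t_n+c\,w_n)\xrightarrow[n\to\infty]{} p(c),$$ where $\mathrm{d}^{(n)}(\cdot)$ denotes the worst-case total variation distance to stationarity of the chain $(X^{(n)}_t)_{t\ge 0}$.
   Context: For an ergodic Markov chain $(X_t)_{t\ge0}$ on a finite state space $S$ with stationary distribution $\pi$, let $\mu_{x,t}$ be the law of $X_t$ conditioned on $X_0=x$. The distance to stationarity is $\mathrm{d}(t)=\max_{x\in S}\mathrm{d}_{TV}(\mu_{x,t},\pi)$, where $\mathrm{d}_{TV}(\mu,\nu)=\max_{A\subset S}|\mu(A)-\nu(A)|=\frac12\sum_{x\in S}|\mu(x)-\nu(x)|$. For fixed $c$, the time $t_n+cw_n$ is nonnegative for all large enough $n$, so the limit is meaningful. State spaces may depend on $n$. *)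

theory Defs
  imports "HOL-Probability.Probability"
begin

text \<open>
  A time-homogeneous continuous-time Markov chain on a finite state space \<open>S\<close> is a process
  \<open>X\<close> together with the family of measures \<open>P x\<close> (\<open>x \<in> S\<close>) on one measurable space, where
  \<open>P x\<close> governs the chain conditioned on \<open>X\<^sub>0 = x\<close>. The process is only constrained at times \<open>t \<ge> 0\<close>.
  The axiom \<open>markov\<close> is the elementary Markov property
    \<open>P\<^sub>x(X\<^sub>s\<^sub>+\<^sub>t = z | X\<^sub>u = a u for u \<in> U, X\<^sub>s = y) = P\<^sub>y(X\<^sub>t = z)\<close>
  for finite sets \<open>U\<close> of times in \<open>[0, s]\<close>, multiplied out so that null conditions need no exception.
  The axiom \<open>standard\<close> is the usual continuity at 0 of the transition function; on a finite
  state space it amounts to \<open>P\<^sub>x(X\<^sub>t = y) = (exp (t Q))\<^sub>x\<^sub>y\<close> for a matrix \<open>Q\<close> of jump rates.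
\<close>

locale finite_markov_chain =
  fixes S :: "'s set" and P :: "'s \<Rightarrow> 'w measure" and X :: "real \<Rightarrow> 'w \<Rightarrow> 's"
  assumes finite_states: "finite S" and states_nonempty: "S \<noteq> {}"
    and prob: "x \<in> S \<Longrightarrow> prob_space (P x)"
    and same_sets: "x \<in> S \<Longrightarrow> y \<in> S \<Longrightarrow> sets (P x) = sets (P y)"
    and random_variable: "x \<in> S \<Longrightarrow> t \<ge> 0 \<Longrightarrow> X t \<in> measurable (P x) (count_space S)"
    and start: "x \<in> S \<Longrightarrow> AE \<omega> in P x. X 0 \<omega> = x"
    and markov: "x \<in> S \<Longrightarrow> y \<in> S \<Longrightarrow> z \<in> S \<Longrightarrow> s \<ge> 0 \<Longrightarrow> t \<ge> 0 \<Longrightarrow>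
        finite U \<Longrightarrow> U \<subseteq> {0..s} \<Longrightarrow>
        measure (P x) {\<omega> \<in> space (P x). (\<forall>u\<in>U. X u \<omega> = a u) \<and> X s \<omega> = y \<and> X (s + t) \<omega> = z}
        = measure (P x) {\<omega> \<in> space (P x). (\<forall>u\<in>U. X u \<omega> = a u) \<and> X s \<omega> = y}
          * measure (P y) {\<omega> \<in> space (P y). X t \<omega> = z}"
    and standard: "x \<in> S \<Longrightarrow>
        ((\<lambda>t. measure (P x) {\<omega> \<in> space (P x). X t \<omega> = x}) \<longlongrightarrow> 1) (at_right 0)"

definition law_at ::
  "'s set \<Rightarrow> ('s \<Rightarrow> 'w measure) \<Rightarrow> (real \<Rightarrow> 'w \<Rightarrow> 's) \<Rightarrow> 's \<Rightarrow> real \<Rightarrow> 's measure" where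
  "law_at S P X x t = distr (P x) (count_space S) (X t)"

text \<open>
  In continuous time there is no periodicity, so on a finite state space ergodicity is irreducibility.
\<close>

definition ergodic_chain ::
  "'s set \<Rightarrow> ('s \<Rightarrow> 'w measure) \<Rightarrow> (real \<Rightarrow> 'w \<Rightarrow> 's) \<Rightarrow> bool" where
  "ergodic_chain S P X \<longleftrightarrow> finite_markov_chain S P X \<and>
     (\<forall>x\<in>S. \<forall>y\<in>S. \<exists>t\<ge>0. measure (law_at S P X x t) {y} > 0)"

definition stationary_distribution ::
  "'s set \<Rightarrow> ('s \<Rightarrow> 'w measure) \<Rightarrow> (real \<Rightarrow> 'w \<Rightarrow> 's) \<Rightarrow> 's pmf \<Rightarrow> bool" where
  "stationary_distribution S P X \<pi> \<longleftrightarrow> set_pmf \<pi> \<subseteq> S \<and>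
     (\<forall>t\<ge>0. \<forall>y\<in>S. (\<Sum>x\<in>S. pmf \<pi> x * measure (law_at S P X x t) {y}) = pmf \<pi> y)"

definition tv_dist :: "'s set \<Rightarrow> 's measure \<Rightarrow> 's measure \<Rightarrow> real" where
  "tv_dist S \<mu> \<nu> = Max ((\<lambda>A. \<bar>measure \<mu> A - measure \<nu> A\<bar>) ` Pow S)"

definition dist_to_stationarity ::
  "'s set \<Rightarrow> ('s \<Rightarrow> 'w measure) \<Rightarrow> (real \<Rightarrow> 'w \<Rightarrow> 's) \<Rightarrow> 's pmf \<Rightarrow> real \<Rightarrow> real" where
  "dist_to_stationarity S P X \<pi> t =
     Max ((\<lambda>x. tv_dist S (law_at S P X x t) (measure_pmf \<pi>)) ` S)"

end

theory Submission
  imports Defs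
begin

text \<open>
  Run a discrete chain at the points of a rate 1 Poisson process: by Chebyshev's inequality the number of
  steps up to time \<open>t + c w\<close> is \<open>t + c w + o(w)\<close>, because \<open>sqrt t\<close> is negligible compared to \<open>w\<close>.
  The discrete chain has a bulk state \<open>N\<close> and walks deterministically along \<open>0, 1, 2, \<dots>\<close>, except that
  it falls into the bulk at a random step, the walk surviving \<open>k\<close> steps with probability
  \<open>p ((k - t) / w)\<close>. It leaves the bulk, towards \<open>0\<close>, with a tiny probability only. Then the
  stationary distribution is nearly the point mass at \<open>N\<close>, and the distance to stationarity is nearly
  the probability of not having reached \<open>N\<close> yet.
\<close>

section \<open>Markov chains from transition semigroups\<close>

text \<open>The obstacle is the maximum over the starting states. From state \<open>x\<close>, the
  chance of surviving \<open>j\<close> more steps is the conditional probability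
  \<open>s (x + j) / s x\<close>, which may be far larger than \<open>s j\<close> where the profile
  is already small. Confining the descent of \<open>s\<close> to a window of half-width
  \<open>sqrt (t * w)\<close> resolves this: before the window \<open>s x = 1\<close>, so the
  quotient is at most \<open>s j\<close>, and from inside it the bulk is at most about
  \<open>2 * sqrt (t * w)\<close> steps away, far fewer than the roughly \<open>t\<close> steps that
  are run. The random number of steps shifts the argument of \<open>p\<close> by at most some small
  \<delta>, outside an event of probability of order \<open>t / (\<delta> * w)\<^sup>2\<close>.
  Monotonicity of \<open>p\<close> turns this into the bounds \<open>p (c + \<delta>)\<close> and
  \<open>p (c - \<delta>)\<close>, and continuity closes the gap between them. Since a chain here
  means a process with all its finite-dimensional laws, a transition semigroup does not suffice:
  measures on path space have to be constructed from it.\<close>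

lemma sorted_list_of_set_insert_greatest:
  assumes "finite A" "\<And>a. a \<in> A \<Longrightarrow> a < m"
  shows "sorted_list_of_set (insert m A) = sorted_list_of_set A @ [m]"
proof (rule sorted_distinct_set_unique)
  show "sorted (sorted_list_of_set A @ [m])"
    using assms by (auto simp: sorted_append intro: less_imp_le)
qed (use assms in \<open>auto simp del: sorted_list_of_set_insert_remove\<close>)

locale transition_semigroup =
  fixes S :: "'s::countable set" and T :: "real \<Rightarrow> 's \<Rightarrow> 's pmf"
  assumes finite_S: "finite S" and S_nonempty: "S \<noteq> {}"
    and T_closed: "x \<in> S \<Longrightarrow> t \<ge> 0 \<Longrightarrow> set_pmf (T t x) \<subseteq> S"
    and T_0: "T 0 x = return_pmf x"
    and T_add: "s \<ge> 0 \<Longrightarrow> t \<ge> 0 \<Longrightarrow> bind_pmf (T s x) (T t) = T (s + t) x"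
    and T_continuous: "x \<in> S \<Longrightarrow> ((\<lambda>t. pmf (T t x) x) \<longlongrightarrow> 1) (at_right 0)"
begin

section \<open>Finite-dimensional laws and their consistency\<close>

primrec joint_law :: "real \<Rightarrow> 's \<Rightarrow> real list \<Rightarrow> (real \<Rightarrow> 's) pmf" where
  "joint_law r x [] = return_pmf (\<lambda>_. undefined)"
| "joint_law r x (t # ts) =
     bind_pmf (T (t - r) x) (\<lambda>y. map_pmf (\<lambda>f. f(t := y)) (joint_law t y ts))"

primrec path_weight :: "real \<Rightarrow> 's \<Rightarrow> real list \<Rightarrow> (real \<Rightarrow> 's) \<Rightarrow> real" where
  "path_weight r x [] a = 1"
| "path_weight r x (t # ts) a = pmf (T (t - r) x) (a t) * path_weight t (a t) ts a"

lemma measure_joint_law: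
  "distinct ts \<Longrightarrow>
    measure_pmf.prob (joint_law r x ts) {f. \<forall>u\<in>set ts. f u = a u} = path_weight r x ts a"
proof (induction ts arbitrary: r x)
  case Nil
  then show ?case by simp
next
  case (Cons t ts)
  \<comment> \<open>Only \<open>y = a t\<close> contributes. The update at \<open>t\<close> does not
    disturb the conditions on \<open>ts\<close>, because the times are distinct.\<close>
  have vim: "(\<lambda>f. f(t := y)) -` {f. \<forall>u\<in>set (t # ts). f u = a u} =
      (if y = a t then {f. \<forall>u\<in>set ts. f u = a u} else {})" for y
    using Cons.prems by auto
  have "ennreal (measure_pmf.prob (joint_law r x (t # ts)) {f. \<forall>u\<in>set (t # ts). f u = a u}) =
      (\<integral>\<^sup>+y. emeasure (joint_law t y ts) (if y = a t then {f. \<forall>u\<in>set ts. f u = a u} else {}) \<partial>T (t - r) x)"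
    by (simp only: measure_pmf.emeasure_eq_measure[symmetric] joint_law.simps emeasure_bind_pmf
        emeasure_map_pmf vim)
  also have "\<dots> = (\<integral>\<^sup>+y. ennreal (path_weight t (a t) ts a) * indicator {a t} y \<partial>T (t - r) x)"
    using Cons by (intro nn_integral_cong) (auto simp: measure_pmf.emeasure_eq_measure)
  also have "\<dots> = ennreal (path_weight r x (t # ts) a)"
    by (subst nn_integral_cmult) (simp_all add: emeasure_pmf_single ennreal_mult'' mult.commute)
  finally show ?case
    using Cons(1)[of "t" "a t"] Cons.prems
    by (subst (asm) ennreal_inj) (auto intro!: mult_nonneg_nonneg simp flip: Cons(1))
qed

lemma joint_law_closed:
  "x \<in> S \<Longrightarrow> sorted (r # ts) \<Longrightarrow> f \<in> set_pmf (joint_law r x ts) \<Longrightarrow> u \<in> set ts \<Longrightarrow> f u \<in> S"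
proof (induction ts arbitrary: r x f)
  case (Cons t ts)
  then obtain y g where y: "y \<in> set_pmf (T (t - r) x)"
    and g: "g \<in> set_pmf (joint_law t y ts)" and f: "f = g(t := y)" by auto
  have "y \<in> S" using y T_closed[of x "t - r"] Cons.prems by auto
  then show ?case using Cons.IH[of y t g] Cons.prems g f by (cases "u = t") auto
qed simp

text \<open>Chapman-Kolmogorov: a state at an unlisted time \<open>t\<close> is summed out by
  merging the transitions into and out of it.\<close>

lemma bind_joint_law:
  "r \<le> t \<Longrightarrow> sorted (t # ts) \<Longrightarrow> bind_pmf (T (t - r) x) (\<lambda>y. joint_law t y ts) = joint_law r x ts"
proof (cases ts)
  case (Cons t' ts')
  assume "r \<le> t" "sorted (t # ts)"
  then have "T (t' - r) x = bind_pmf (T (t - r) x) (T (t' - t))"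
    using Cons by (subst T_add) auto
  then show ?thesis using Cons by (simp add: bind_assoc_pmf)
qed simp

text \<open>This is the consistency required for the extension theorem. A dropped time is summed out
  by \<open>bind_joint_law\<close>. Equality of the laws themselves is possible because
  \<open>joint_law\<close> takes the value \<open>undefined\<close> off the listed times, exactly as
  \<open>restrict\<close> does.\<close>

lemma joint_law_filter:
  "sorted (r # ts) \<Longrightarrow>
    joint_law r x (filter (\<lambda>u. u \<in> J) ts) = map_pmf (\<lambda>f. restrict f J) (joint_law r x ts)"
proof (induction ts arbitrary: r x)
  case Nil
  then show ?case by (simp add: restrict_def)
next
  case (Cons t ts)
  have IH: "joint_law t y (filter (\<lambda>u. u \<in> J) ts) = map_pmf (\<lambda>f. restrict f J) (joint_law t y ts)" for y
    using Cons.prems by (intro Cons.IH) simp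
  show ?case
  proof (cases "t \<in> J")
    case True
    then have "restrict (f(t := y)) J = (restrict f J)(t := y)" for f :: "real \<Rightarrow> 's" and y
      by auto
    then show ?thesis using True
      by (simp add: IH map_bind_pmf pmf.map_comp comp_def del: restrict_apply)
  next
    case False
    then have "restrict (f(t := y)) J = restrict f J" for f :: "real \<Rightarrow> 's" and y
      by (auto simp: restrict_def)
    moreover have "bind_pmf (T (t - r) x) (\<lambda>y. joint_law t y (filter (\<lambda>u. u \<in> J) ts)) =
        joint_law r x (filter (\<lambda>u. u \<in> J) ts)"
      using Cons.prems by (intro bind_joint_law) (auto intro: sorted_wrt_filter)
    ultimately show ?thesis using False
      by (simp add: IH map_bind_pmf pmf.map_comp comp_def del: restrict_apply)
  qed
qed

text \<open>
  Kolmogorov's extension theorem is available for Polish spaces only, hence the detour through the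
  discrete copy of \<open>'s\<close>. Afterwards \<open>to_state\<close> sends the values outside \<open>S\<close>, which occur with
  probability 0 at each time, to some point of \<open>S\<close>.
\<close>

definition marginal :: "'s \<Rightarrow> real set \<Rightarrow> (real \<Rightarrow> 's discrete) measure" where
  "marginal x J = distr (measure_pmf (joint_law 0 x (sorted_list_of_set J)))
     (PiM J (\<lambda>_. borel)) (\<lambda>f. restrict (\<lambda>u. discrete (f u)) J)"

lemma projective_marginal: "polish_projective {0..} (marginal x)"
proof (intro polish_projective.intro projective_family.intro)
  fix J H :: "real set" assume JH: "J \<subseteq> H" "finite H" "H \<subseteq> {0..}"
  have "sorted_list_of_set J = filter (\<lambda>u. u \<in> J) (sorted_list_of_set H)"
    using JH finite_subset[OF JH(1,2)]
    by (intro sorted_distinct_set_unique) (auto intro: sorted_wrt_filter)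
  moreover have "sorted (0 # sorted_list_of_set H)" using JH by auto
  ultimately have "joint_law 0 x (sorted_list_of_set J) =
      map_pmf (\<lambda>f. restrict f J) (joint_law 0 x (sorted_list_of_set H))"
    by (simp only: joint_law_filter)
  moreover have "restrict (\<lambda>u. discrete (restrict f J u)) J =
      restrict (restrict (\<lambda>u. discrete (f u)) H) J" for f :: "real \<Rightarrow> 's"
    using JH(1) by (auto simp: fun_eq_iff restrict_def)
  ultimately show "marginal x J = distr (marginal x H) (PiM J (\<lambda>_. borel)) (\<lambda>f. restrict f J)"
    using JH(1) unfolding marginal_def
    by (simp add: map_pmf_rep_eq distr_distr comp_def space_PiM measurable_restrict_subset
        del: restrict_apply)
next
  fix J :: "real set"
  show "prob_space (marginal x J)"
    unfolding marginal_def by (intro measure_pmf.prob_space_distr) (auto simp: space_PiM)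
qed

definition to_state :: "'s discrete \<Rightarrow> 's" where
  "to_state d = (if of_discrete d \<in> S then of_discrete d else (SOME y. y \<in> S))"

text \<open>\<open>random_variable\<close> demands values in \<open>S\<close> at every sample point,
  not just almost surely; hence the push-forward to paths that stay in \<open>S\<close>.\<close>

definition path_measure :: "'s \<Rightarrow> (real \<Rightarrow> 's) measure" where
  "path_measure x = distr (projective_family.lim {0..} (marginal x) (\<lambda>_. borel))
     (PiM {0..} (\<lambda>_. count_space S)) (\<lambda>\<omega>. \<lambda>u\<in>{0..}. to_state (\<omega> u))"

lemma to_state_in: "to_state d \<in> S"
  using S_nonempty by (auto simp: to_state_def some_in_eq)

lemma measurable_to_state: "to_state \<in> borel \<rightarrow>\<^sub>M count_space S"
  using finite_S to_state_in
  by (auto simp: measurable_count_space_eq2 borel_open open_discrete)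

lemma measurable_states:
  "(\<lambda>\<omega>. \<lambda>u\<in>{0..}. to_state (\<omega> u)) \<in> PiM {0..} (\<lambda>_. borel) \<rightarrow>\<^sub>M PiM {0..} (\<lambda>_. count_space S)"
  by (intro measurable_restrict measurable_compose[OF _ measurable_to_state]
      measurable_component_singleton)

lemma space_path_measure: "space (path_measure x) = (\<Pi>\<^sub>E u\<in>{0..}. S)"
  by (simp add: path_measure_def space_PiM)

lemma sets_path_measure: "sets (path_measure x) = sets (PiM {0..} (\<lambda>_. count_space S))"
  by (simp add: path_measure_def)

lemma prob_space_path_measure: "prob_space (path_measure x)"
proof -
  interpret polish_projective "{0..}" "marginal x" by (rule projective_marginal)
  show ?thesis unfolding path_measure_def
    by (intro P.prob_space_distr) (use measurable_states in \<open>simp cong: measurable_cong_sets\<close>)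
qed

lemma measurable_coordinate: "u \<ge> 0 \<Longrightarrow> (\<lambda>\<omega>. \<omega> u) \<in> path_measure x \<rightarrow>\<^sub>M count_space S"
  by (simp add: path_measure_def)

lemma sets_coordinate:
  assumes "u \<ge> 0"
  shows "{\<omega> \<in> space (path_measure x). \<omega> u = c} \<in> sets (path_measure x)"
proof -
  have "{\<omega> \<in> space (path_measure x). \<omega> u = c} =
      (\<lambda>\<omega>. \<omega> u) -` ({c} \<inter> S) \<inter> space (path_measure x)"
    using assms by (auto simp: space_path_measure)
  then show ?thesis
    using measurable_sets[OF measurable_coordinate[OF assms], of "{c} \<inter> S" x] by simp
qed

lemma measure_path_measure:
  assumes "x \<in> S" and J: "finite J" "J \<subseteq> {0..}"
  shows "measure (path_measure x) {\<omega> \<in> space (path_measure x). \<forall>u\<in>J. \<omega> u = a u} =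
    path_weight 0 x (sorted_list_of_set J) a"
proof -
  interpret polish_projective "{0..}" "marginal x" by (rule projective_marginal)
  define E where "E = {\<omega> \<in> space (PiM J (\<lambda>_. borel)). \<forall>u\<in>J. to_state (\<omega> u) = a u}"
  have E: "E \<in> sets (PiM J (\<lambda>_. borel))"
  proof -
    have "E = (\<Pi>\<^sub>E u\<in>J. {d. to_state d = a u})"
      unfolding E_def by (auto simp: space_PiM PiE_iff extensional_def)
    then show ?thesis using J by (auto intro!: sets_PiM_I_finite borel_open open_discrete)
  qed
  have A: "{\<omega> \<in> space (path_measure x). \<forall>u\<in>J. \<omega> u = a u} \<in> sets (path_measure x)"
    using J by (cases "J = {}") (auto intro!: sets.sets_Collect_finite_All' sets_coordinate)
  have "measure (path_measure x) {\<omega> \<in> space (path_measure x). \<forall>u\<in>J. \<omega> u = a u} =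
      measure lim (emb {0..} J E)"
    using A unfolding path_measure_def
    apply (subst measure_distr)
    subgoal using measurable_states by (simp cong: measurable_cong_sets)
    subgoal by simp
    subgoal using J by (intro arg_cong[where f="measure lim"])
       (auto simp: E_def prod_emb_def space_PiM to_state_in)
    done
  also have "\<dots> = measure (marginal x J) E"
    using J E by (intro measure_lim_emb) auto
  also have "\<dots> = measure_pmf.prob (joint_law 0 x (sorted_list_of_set J))
      {f. \<forall>u\<in>J. to_state (discrete (f u)) = a u}"
    unfolding marginal_def using E
    by (subst measure_distr) (auto simp: E_def space_PiM intro!: arg_cong2[where f=measure])
  \<comment> \<open>The joint law charges only functions with values in \<open>S\<close> on
    \<open>J\<close>, and there \<open>to_state\<close> undoes \<open>discrete\<close>.\<close>
  also have "\<dots> = measure_pmf.prob (joint_law 0 x (sorted_list_of_set J))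
      {f. \<forall>u\<in>set (sorted_list_of_set J). f u = a u}"
  proof (intro measure_pmf.finite_measure_eq_AE AE_pmfI)
    fix f assume f: "f \<in> set_pmf (joint_law 0 x (sorted_list_of_set J))"
    have "f u \<in> S" if "u \<in> J" for u
      using joint_law_closed[OF assms(1) _ f] J that by auto
    then show "f \<in> {f. \<forall>u\<in>J. to_state (discrete (f u)) = a u} \<longleftrightarrow>
        f \<in> {f. \<forall>u\<in>set (sorted_list_of_set J). f u = a u}"
      using J by (auto simp: to_state_def discrete_inverse)
  qed auto
  also have "\<dots> = path_weight 0 x (sorted_list_of_set J) a"
    by (rule measure_joint_law) simp
  finally show ?thesis .
qed

section \<open>One-time laws and the Markov property of the path measure\<close>

lemma measure_coordinate:
  assumes "x \<in> S" "t \<ge> 0"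
  shows "measure (path_measure x) {\<omega> \<in> space (path_measure x). \<omega> t = y} = pmf (T t x) y"
  using measure_path_measure[OF assms(1), of "{t}" "\<lambda>_. y"] assms by simp

text \<open>The Markov property in algebraic form: the second factor sees the first list only
  through its last time and the state there.\<close>

lemma path_weight_append:
  "ts \<noteq> [] \<Longrightarrow> path_weight r x (ts @ us) a =
    path_weight r x ts a * path_weight (last ts) (a (last ts)) us a"
  by (induction ts arbitrary: r x) auto

lemma measure_markov:
  assumes "x \<in> S" "finite U" "U \<subseteq> {0..s}" "s \<ge> 0" "t \<ge> 0"
  shows "measure (path_measure x)
      {\<omega> \<in> space (path_measure x). (\<forall>u\<in>U. \<omega> u = a u) \<and> \<omega> s = y \<and> \<omega> (s + t) = z} =
    measure (path_measure x) {\<omega> \<in> space (path_measure x). (\<forall>u\<in>U. \<omega> u = a u) \<and> \<omega> s = y} *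
    pmf (T t y) z"
\<comment> \<open>If two constraints clash at a coinciding time, both sides are 0. Otherwise one
  function \<open>b\<close> can record all of them.\<close>
proof (cases "(s \<in> U \<longrightarrow> a s = y) \<and> (t = 0 \<longrightarrow> y = z)")
  case False
  then consider "s \<in> U" "a s \<noteq> y" | "t = 0" "y \<noteq> z" by blast
  then show ?thesis
  proof cases
    case 1
    then have "\<not> ((\<forall>u\<in>U. \<omega> u = a u) \<and> \<omega> s = y)" for \<omega> :: "real \<Rightarrow> 's"
      by metis
    then have "{\<omega> \<in> space (path_measure x). (\<forall>u\<in>U. \<omega> u = a u) \<and> \<omega> s = y} = {}"
      and "{\<omega> \<in> space (path_measure x). (\<forall>u\<in>U. \<omega> u = a u) \<and> \<omega> s = y \<and> \<omega> (s + t) = z} = {}"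
      by blast+
    then show ?thesis by (simp only: measure_empty mult_zero_left)
  next
    case 2
    then have "{\<omega> \<in> space (path_measure x). (\<forall>u\<in>U. \<omega> u = a u) \<and> \<omega> s = y \<and> \<omega> (s + t) = z} = {}"
      by auto
    moreover have "pmf (T t y) z = 0" using 2 by (simp add: T_0)
    ultimately show ?thesis by (simp only: measure_empty mult_zero_right)
  qed
next
  case True
  \<comment> \<open>For \<open>t = 0\<close> the second update overwrites the first, harmlessly
    since then \<open>y = z\<close>.\<close>
  define b where "b = a(s := y, s + t := z)"
  define V where "V = insert s U"
  have V: "finite V" "V \<subseteq> {0..s}" using assms by (auto simp: V_def)
  have bU: "b u = a u" if "u \<in> U" for u
  proof -
    have "u \<le> s" using assms that by auto
    then show ?thesis using True that \<open>t \<ge> 0\<close> by (cases "u = s") (auto simp: b_def)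
  qed
  have bs: "b s = y" using True by (simp add: b_def)
  have past: "{\<omega> \<in> space (path_measure x). (\<forall>u\<in>U. \<omega> u = a u) \<and> \<omega> s = y} =
      {\<omega> \<in> space (path_measure x). \<forall>u\<in>V. \<omega> u = b u}"
    by (simp add: V_def bU bs conj_commute)
  have last: "sorted_list_of_set V \<noteq> []" "last (sorted_list_of_set V) = s"
  proof -
    have "sorted_list_of_set V = sorted_list_of_set (V - {s}) @ [s]"
      using sorted_list_of_set_insert_greatest[of "V - {s}" s] V
      by (simp add: V_def insert_absorb less_le subset_iff)
    then show "last (sorted_list_of_set V) = s" "sorted_list_of_set V \<noteq> []"
      by simp_all
  qed
  show ?thesis
  proof (cases "t = 0")
    case True
    moreover have "y = z" using \<open>(s \<in> U \<longrightarrow> a s = y) \<and> (t = 0 \<longrightarrow> y = z)\<close> True by simp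
    ultimately show ?thesis by (simp add: T_0)
  next
    case False
    with assms have "t > 0" by simp
    have future: "{\<omega> \<in> space (path_measure x). (\<forall>u\<in>U. \<omega> u = a u) \<and> \<omega> s = y \<and> \<omega> (s + t) = z} =
        {\<omega> \<in> space (path_measure x). \<forall>u\<in>insert (s + t) V. \<omega> u = b u}"
    proof -
      have "b (s + t) = z" by (simp add: b_def)
      then show ?thesis by (simp add: V_def bU bs) blast
    qed
    have "sorted_list_of_set (insert (s + t) V) = sorted_list_of_set V @ [s + t]"
      using V \<open>t > 0\<close> by (intro sorted_list_of_set_insert_greatest) force+
    moreover have "b s = y" "b (s + t) = z" using False by (auto simp: b_def)
    moreover have "V \<subseteq> {0..}" "insert (s + t) V \<subseteq> {0..}" using V assms by auto
    ultimately show ?thesis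
      using measure_path_measure[OF assms(1), of V b]
        measure_path_measure[OF assms(1), of "insert (s + t) V" b] V
      unfolding past future by (simp only: path_weight_append[OF last(1)] last(2)) simp
  qed
qed

lemma finite_markov_chain_path_measure: "finite_markov_chain S path_measure (\<lambda>t \<omega>. \<omega> t)"
proof (rule finite_markov_chain.intro)
  show "prob_space (path_measure x)" for x by (rule prob_space_path_measure)
next
  fix x assume x: "x \<in> S"
  interpret prob_space "path_measure x" by (rule prob_space_path_measure)
  have "prob {\<omega> \<in> space (path_measure x). \<omega> 0 = x} = 1"
    using measure_coordinate[OF x, of 0 x] by (simp add: T_0)
  then have "AE \<omega> in path_measure x. \<omega> \<in> {\<omega> \<in> space (path_measure x). \<omega> 0 = x}"
    by (intro prob_eq_1[THEN iffD1]) (auto intro: sets_coordinate)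
  then show "AE \<omega> in path_measure x. \<omega> 0 = x" by auto
  have "eventually (\<lambda>t. pmf (T t x) x = measure (path_measure x) {\<omega> \<in> space (path_measure x). \<omega> t = x}) (at_right 0)"
    using eventually_at_right_less[of 0]
    by eventually_elim (simp add: measure_coordinate x)
  from Lim_transform_eventually[OF T_continuous[OF x] this]
  show "((\<lambda>t. measure (path_measure x) {\<omega> \<in> space (path_measure x). \<omega> t = x}) \<longlongrightarrow> 1) (at_right 0)" .
qed (auto simp: finite_S S_nonempty sets_path_measure measurable_coordinate measure_markov
    measure_coordinate)

lemma law_at_path_measure:
  assumes "x \<in> S" "t \<ge> 0" "A \<subseteq> S"
  shows "measure (law_at S path_measure (\<lambda>t \<omega>. \<omega> t) x t) A = measure_pmf.prob (T t x) A"
proof -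
  have "finite A" using assms finite_S finite_subset by blast
  interpret L: prob_space "law_at S path_measure (\<lambda>t \<omega>. \<omega> t) x t"
    unfolding law_at_def using assms
    by (intro prob_space.prob_space_distr prob_space_path_measure measurable_coordinate)
  have "L.prob {y} = pmf (T t x) y" if "y \<in> A" for y
    using measure_coordinate[of x t y] assms that unfolding law_at_def
    by (subst measure_distr) (auto simp: measurable_coordinate vimage_def Int_def conj_commute)
  then show ?thesis
    using \<open>finite A\<close> assms
    by (subst L.finite_measure_eq_sum_singleton)
      (auto simp: measure_measure_pmf_finite law_at_def subset_iff)
qed

end

section \<open>Poissonization\<close>

text \<open>\<open>poisson_pmf\<close> is meant for positive rates; at time 0 the point mass at 0 is
  what \<open>T_0\<close> requires.\<close>

definition poisson_law :: "real \<Rightarrow> nat pmf" where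
  "poisson_law r = (if r > 0 then poisson_pmf r else return_pmf 0)"

lemma pmf_poisson_law: "r \<ge> 0 \<Longrightarrow> pmf (poisson_law r) k = r ^ k / fact k * exp (- r)"
  by (cases k) (auto simp: poisson_law_def pmf_return)

lemma poisson_law_add:
  assumes "r \<ge> 0" "s \<ge> 0"
  shows "bind_pmf (poisson_law r) (\<lambda>i. map_pmf ((+) i) (poisson_law s)) = poisson_law (r + s)"
proof (rule pmf_eqI)
  fix k
  have shift: "pmf (map_pmf ((+) i) (poisson_law s)) k = (if i \<le> k then pmf (poisson_law s) (k - i) else 0)" for i
  proof (cases "i \<le> k")
    case True
    then have "pmf (map_pmf ((+) i) (poisson_law s)) (i + (k - i)) = pmf (poisson_law s) (k - i)"
      by (intro pmf_map_inj') (auto simp: inj_def)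
    then show ?thesis using True by simp
  next
    case False
    then show ?thesis by (auto simp: pmf_eq_0_set_pmf)
  qed
  have "pmf (bind_pmf (poisson_law r) (\<lambda>i. map_pmf ((+) i) (poisson_law s))) k =
      (\<Sum>i\<le>k. pmf (poisson_law r) i * pmf (poisson_law s) (k - i))"
    unfolding pmf_bind shift
    by (subst integral_measure_pmf_real[of "{..k}"]) (auto intro!: sum.cong split: if_splits)
  \<comment> \<open>The binomial theorem in the shape of the Cauchy product behind the addition
    formula for \<open>exp\<close>.\<close>
  also have "\<dots> = (\<Sum>i\<le>k. (r ^ i /\<^sub>R fact i) * (s ^ (k - i) /\<^sub>R fact (k - i))) * exp (- (r + s))"
    unfolding sum_distrib_right using assms
    by (intro sum.cong) (simp_all add: pmf_poisson_law exp_diff exp_minus exp_add field_simps)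
  also have "\<dots> = ((r + s) ^ k /\<^sub>R fact k) * exp (- (r + s))"
    by (simp only: exp_series_add_commuting[OF mult.commute])
  also have "\<dots> = pmf (poisson_law (r + s)) k"
    using assms by (simp add: pmf_poisson_law divide_inverse)
  finally show "pmf (bind_pmf (poisson_law r) (\<lambda>i. map_pmf ((+) i) (poisson_law s))) k =
      pmf (poisson_law (r + s)) k" .
qed

text \<open>The index shift \<open>eS\<close> turns the series of \<open>e k\<close> into that of
  \<open>k * e k\<close>, and once more into that of \<open>k * k * e k\<close>; the square is then
  expanded.\<close>

lemma poisson_law_variance:
  assumes "r \<ge> 0"
  shows "(\<lambda>k. pmf (poisson_law r) k * (real k - r)\<^sup>2) sums r"
proof -
  define e where "e k = r ^ k / fact k" for k :: nat
  have e0: "e sums exp r"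
    using exp_converges[of r] by (simp add: e_def[abs_def] divide_inverse mult.commute)
  have eS: "real (Suc k) * e (Suc k) = r * e k" for k by (simp add: e_def field_simps del: of_nat_Suc)
  have "(\<lambda>k. real (Suc k) * e (Suc k)) sums (r * exp r)"
    unfolding eS by (intro sums_mult e0)
  from this[THEN sums_Suc] have e1: "(\<lambda>k. real k * e k) sums (r * exp r)" by simp
  have "real (Suc k) * (r * e k) = r * (real k * e k + e k)" for k by (simp add: algebra_simps)
  then have "(\<lambda>k. real (Suc k) * (real (Suc k) * e (Suc k))) sums (r * (r * exp r + exp r))"
    unfolding eS by (simp only: sums_mult sums_add e0 e1)
  from this[THEN sums_Suc] have e2: "(\<lambda>k. real k * (real k * e k)) sums (r * (r * exp r + exp r))"
    by simp
  have "(\<lambda>k. (real k * (real k * e k) - 2 * r * (real k * e k) + r\<^sup>2 * e k) * exp (- r)) sums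
      ((r * (r * exp r + exp r) - 2 * r * (r * exp r) + r\<^sup>2 * exp r) * exp (- r))"
    by (intro sums_mult2 sums_add sums_diff sums_mult e0 e1 e2)
  also have "(r * (r * exp r + exp r) - 2 * r * (r * exp r) + r\<^sup>2 * exp r) * exp (- r) = r"
    by (simp add: exp_minus field_simps power2_eq_square)
  also have "(\<lambda>k. (real k * (real k * e k) - 2 * r * (real k * e k) + r\<^sup>2 * e k) * exp (- r)) =
      (\<lambda>k. pmf (poisson_law r) k * (real k - r)\<^sup>2)"
  proof
    fix k
    have "pmf (poisson_law r) k = e k * exp (- r)" using assms by (simp add: pmf_poisson_law e_def)
    then show "(real k * (real k * e k) - 2 * r * (real k * e k) + r\<^sup>2 * e k) * exp (- r) =
        pmf (poisson_law r) k * (real k - r)\<^sup>2"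
      by (simp add: power2_eq_square algebra_simps)
  qed
  finally show ?thesis .
qed

lemma poisson_law_deviation:
  assumes "r \<ge> 0" "a > 0"
  shows "measure_pmf.prob (poisson_law r) {k. a \<le> \<bar>real k - r\<bar>} \<le> r / a\<^sup>2"
proof -
  have "ennreal (measure_pmf.prob (poisson_law r) {k. a \<le> \<bar>real k - r\<bar>}) =
      (\<integral>\<^sup>+k. indicator {k. a \<le> \<bar>real k - r\<bar>} k \<partial>poisson_law r)"
    by (simp add: measure_pmf.emeasure_eq_measure)
  also have "\<dots> \<le> (\<integral>\<^sup>+k. ennreal ((real k - r)\<^sup>2 / a\<^sup>2) \<partial>poisson_law r)"
  proof (intro nn_integral_mono)
    fix k
    have "1 \<le> (real k - r)\<^sup>2 / a\<^sup>2" if "a \<le> \<bar>real k - r\<bar>"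
      using power_mono[OF that, of 2] assms by (simp add: field_simps)
    then show "indicator {k. a \<le> \<bar>real k - r\<bar>} k \<le> ennreal ((real k - r)\<^sup>2 / a\<^sup>2)"
      by (auto simp: indicator_def)
  qed
  also have "\<dots> = (\<Sum>k. ennreal (pmf (poisson_law r) k * (real k - r)\<^sup>2 / a\<^sup>2))"
    by (simp add: nn_integral_measure_pmf nn_integral_count_space_nat ennreal_mult'[symmetric])
  also have "\<dots> = ennreal (r / a\<^sup>2)"
    using sums_divide[OF poisson_law_variance[OF assms(1)], of "a\<^sup>2"]
    by (intro suminf_ennreal_eq) auto
  finally show ?thesis using assms by (subst (asm) ennreal_le_iff) auto
qed

lemma pmf_bind_ge: "pmf M a * pmf (f a) y \<le> pmf (bind_pmf M f) y"
proof -
  have "pmf M a * pmf (f a) y = (\<integral>x. pmf (f a) y * indicator {a} x \<partial>M)"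
    by (simp add: measure_pmf_single)
  also have "\<dots> \<le> (\<integral>x. pmf (f x) y \<partial>M)"
    by (intro integral_mono measure_pmf.integrable_const_bound[where B=1])
      (auto simp: pmf_le_1 indicator_def)
  finally show ?thesis by (simp add: pmf_bind)
qed

section \<open>Iterating a kernel at the points of a Poisson process\<close>

primrec kernel_power :: "('s \<Rightarrow> 's pmf) \<Rightarrow> nat \<Rightarrow> 's \<Rightarrow> 's pmf" where
  "kernel_power K 0 x = return_pmf x"
| "kernel_power K (Suc j) x = bind_pmf (K x) (kernel_power K j)"

lemma kernel_power_add:
  "bind_pmf (kernel_power K i x) (kernel_power K j) = kernel_power K (i + j) x"
  by (induction i arbitrary: x) (simp_all add: bind_return_pmf bind_assoc_pmf)

lemma kernel_power_closed:
  "(\<And>x. x \<in> S \<Longrightarrow> set_pmf (K x) \<subseteq> S) \<Longrightarrow> x \<in> S \<Longrightarrow> set_pmf (kernel_power K j x) \<subseteq> S"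
proof (induction j arbitrary: x)
  case (Suc j)
  then have "set_pmf (K x) \<subseteq> S" by blast
  then show ?case
    unfolding kernel_power.simps set_bind_pmf
    by (intro UN_least Suc.IH) (use Suc.prems(1) in blast)+
qed simp

definition poissonized :: "('s \<Rightarrow> 's pmf) \<Rightarrow> real \<Rightarrow> 's \<Rightarrow> 's pmf" where
  "poissonized K t x = bind_pmf (poisson_law t) (\<lambda>j. kernel_power K j x)"

text \<open>The second step count is independent of the first part of the path, so it may be drawn
  in advance; the two counts then add up to a Poisson variable.\<close>

lemma poissonized_add:
  assumes "s \<ge> 0" "t \<ge> 0"
  shows "bind_pmf (poissonized K s x) (poissonized K t) = poissonized K (s + t) x"
proof -
  have "bind_pmf (poissonized K s x) (poissonized K t) =
      bind_pmf (poisson_law s) (\<lambda>i. bind_pmf (poisson_law t)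
        (\<lambda>j. bind_pmf (kernel_power K i x) (kernel_power K j)))"
    unfolding poissonized_def bind_assoc_pmf by (subst bind_commute_pmf) simp
  also have "\<dots> = bind_pmf (bind_pmf (poisson_law s) (\<lambda>i. map_pmf ((+) i) (poisson_law t)))
      (\<lambda>k. kernel_power K k x)"
    by (simp add: kernel_power_add bind_assoc_pmf bind_map_pmf)
  finally show ?thesis using assms by (simp add: poisson_law_add poissonized_def)
qed

lemma transition_semigroup_poissonized:
  fixes S :: "'s::countable set"
  assumes "finite S" "S \<noteq> {}" and K: "\<And>x. x \<in> S \<Longrightarrow> set_pmf (K x) \<subseteq> S"
  shows "transition_semigroup S (poissonized K)"
proof
  show "set_pmf (poissonized K t x) \<subseteq> S" if "x \<in> S" for x t
    using kernel_power_closed[of S K x] K that by (auto simp: poissonized_def)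
  show "bind_pmf (poissonized K s x) (poissonized K t) = poissonized K (s + t) x"
    if "s \<ge> 0" "t \<ge> 0" for s t x
    using that by (rule poissonized_add)
  show "poissonized K 0 x = return_pmf x" for x
    by (simp add: poissonized_def poisson_law_def bind_return_pmf)
  show "((\<lambda>t. pmf (poissonized K t x) x) \<longlongrightarrow> 1) (at_right 0)" for x
  proof (rule tendsto_sandwich)
    \<comment> \<open>\<open>exp (- t)\<close> is the probability of no jump before
      \<open>t\<close>.\<close>
    have "((\<lambda>t::real. exp (- t)) \<longlongrightarrow> exp (- 0)) (at_right 0)" by (intro tendsto_intros)
    then show "((\<lambda>t::real. exp (- t)) \<longlongrightarrow> 1) (at_right 0)" by simp
    show "\<forall>\<^sub>F t in at_right 0. exp (- t) \<le> pmf (poissonized K t x) x"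
      using eventually_at_right_less[of 0]
    proof eventually_elim
      case (elim t)
      then show ?case
        using pmf_bind_ge[of "poisson_law t" 0 "\<lambda>j. kernel_power K j x" x]
        by (simp add: poissonized_def pmf_poisson_law)
    qed
  qed (auto simp: pmf_le_1)
qed (use assms in auto)

text \<open>Estimates at deterministic step counts near \<open>r\<close> carry over to Poisson time:
  on the deviation event only the trivial bounds 0 and 1 are used, which costs its probability, at
  most \<open>r / a\<^sup>2\<close>.\<close>

lemma pmf_poissonized_bounds:
  assumes "r \<ge> 0" "a > 0"
  shows "(\<And>j. \<bar>real j - r\<bar> < a \<Longrightarrow> c \<le> pmf (kernel_power K j x) y) \<Longrightarrow> c \<le> 1 \<Longrightarrow>
      c - r / a\<^sup>2 \<le> pmf (poissonized K r x) y"
    and "(\<And>j. \<bar>real j - r\<bar> < a \<Longrightarrow> pmf (kernel_power K j x) y \<le> c) \<Longrightarrow> 0 \<le> c \<Longrightarrow>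
      pmf (poissonized K r x) y \<le> c + r / a\<^sup>2"
proof -
  let ?D = "{k. a \<le> \<bar>real k - r\<bar>}"
  note dev = poisson_law_deviation[OF assms]
  note int = measure_pmf.integrable_const_bound[where B="\<bar>c\<bar> + 1"]
  {
    assume c: "\<And>j. \<bar>real j - r\<bar> < a \<Longrightarrow> c \<le> pmf (kernel_power K j x) y" "c \<le> 1"
    have "c - measure_pmf.prob (poisson_law r) ?D = (\<integral>j. c - indicator ?D j \<partial>poisson_law r)"
      by (subst Bochner_Integration.integral_diff) (auto simp: less_top[symmetric])
    also have "\<dots> \<le> (\<integral>j. pmf (kernel_power K j x) y \<partial>poisson_law r)"
    proof (intro integral_mono int)
      fix j
      show "c - indicator ?D j \<le> pmf (kernel_power K j x) y"
        using c by (cases "j \<in> ?D") (auto intro: order_trans[OF _ pmf_nonneg])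
      show "AE j in poisson_law r. norm (pmf (kernel_power K j x) y) \<le> \<bar>c\<bar> + 1"
        by (intro AE_I2) (simp add: add_increasing pmf_le_1)
    qed (auto simp: indicator_def)
    finally show "c - r / a\<^sup>2 \<le> pmf (poissonized K r x) y"
      using dev by (simp add: poissonized_def pmf_bind)
  }
  {
    assume c: "\<And>j. \<bar>real j - r\<bar> < a \<Longrightarrow> pmf (kernel_power K j x) y \<le> c" "0 \<le> c"
    have "(\<integral>j. pmf (kernel_power K j x) y \<partial>poisson_law r) \<le>
        (\<integral>j. c + indicator ?D j \<partial>poisson_law r)"
    proof (intro integral_mono int)
      fix j
      show "pmf (kernel_power K j x) y \<le> c + indicator ?D j"
        using c by (cases "j \<in> ?D") (auto intro: order_trans[OF pmf_le_1])
      show "AE j in poisson_law r. norm (pmf (kernel_power K j x) y) \<le> \<bar>c\<bar> + 1"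
        by (intro AE_I2) (simp add: add_increasing pmf_le_1)
    qed (auto simp: indicator_def)
    also have "\<dots> = c + measure_pmf.prob (poisson_law r) ?D"
      by (subst Bochner_Integration.integral_add) (auto simp: less_top[symmetric])
    finally show "pmf (poissonized K r x) y \<le> c + r / a\<^sup>2"
      using dev by (simp add: poissonized_def pmf_bind)
  }
qed

lemma bind_poissonized_stationary:
  assumes "bind_pmf \<pi> K = \<pi>"
  shows "bind_pmf \<pi> (poissonized K t) = \<pi>"
proof -
  have "bind_pmf \<pi> (kernel_power K j) = \<pi>" for j
  proof (induction j)
    case 0
    then show ?case by (simp add: bind_return_pmf')
  next
    case (Suc j)
    have "bind_pmf \<pi> (kernel_power K (Suc j)) = bind_pmf (bind_pmf \<pi> K) (kernel_power K j)"
      by (subst bind_assoc_pmf) (intro bind_pmf_cong, simp_all)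
    also have "\<dots> = \<pi>" by (simp only: assms Suc)
    finally show ?case .
  qed
  then show ?thesis
    unfolding poissonized_def by (subst bind_commute_pmf) simp
qed

lemma ergodic_chain_poissonized:
  fixes S :: "'s::countable set"
  assumes "transition_semigroup S (poissonized K)"
    and reach: "\<And>x y. x \<in> S \<Longrightarrow> y \<in> S \<Longrightarrow> \<exists>j. pmf (kernel_power K j x) y > 0"
  shows "ergodic_chain S (transition_semigroup.path_measure S (poissonized K)) (\<lambda>t \<omega>. \<omega> t)"
proof -
  interpret transition_semigroup S "poissonized K" by fact
  have "\<exists>t\<ge>0. measure (law_at S path_measure (\<lambda>t \<omega>. \<omega> t) x t) {y} > 0" if xy: "x \<in> S" "y \<in> S" for x y
  proof -
    obtain j where j: "pmf (kernel_power K j x) y > 0" using reach xy by blast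
    have "0 < pmf (poisson_law 1) j * pmf (kernel_power K j x) y"
      using j by (simp add: pmf_poisson_law)
    also have "\<dots> \<le> pmf (poissonized K 1 x) y"
      unfolding poissonized_def by (rule pmf_bind_ge)
    finally have "measure (law_at S path_measure (\<lambda>t \<omega>. \<omega> t) x 1) {y} > 0"
      using xy by (simp add: law_at_path_measure measure_pmf_single)
    then show ?thesis by (intro exI[of _ 1]) simp
  qed
  then show ?thesis
    using finite_markov_chain_path_measure by (simp add: ergodic_chain_def)
qed

lemma stationary_distribution_poissonized:
  fixes S :: "'s::countable set"
  assumes "transition_semigroup S (poissonized K)" "set_pmf \<pi> \<subseteq> S" "bind_pmf \<pi> K = \<pi>"
  shows "stationary_distribution S (transition_semigroup.path_measure S (poissonized K))
    (\<lambda>t \<omega>. \<omega> t) \<pi>"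
proof -
  interpret transition_semigroup S "poissonized K" by fact
  have "(\<Sum>x\<in>S. pmf \<pi> x * measure (law_at S path_measure (\<lambda>t \<omega>. \<omega> t) x t) {y}) = pmf \<pi> y"
    if "t \<ge> 0" "y \<in> S" for t y
  proof -
    have "(\<Sum>x\<in>S. pmf \<pi> x * measure (law_at S path_measure (\<lambda>t \<omega>. \<omega> t) x t) {y}) =
        (\<Sum>x\<in>S. pmf \<pi> x * pmf (poissonized K t x) y)"
      using that by (intro sum.cong) (simp_all add: law_at_path_measure measure_pmf_single)
    also have "\<dots> = pmf (bind_pmf \<pi> (poissonized K t)) y"
      unfolding pmf_bind using assms(2) finite_S
      by (subst integral_measure_pmf_real[of S]) (auto simp: mult.commute)
    finally show ?thesis by (simp add: bind_poissonized_stationary[OF assms(3)])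
  qed
  then show ?thesis using assms(2) by (auto simp: stationary_distribution_def)
qed

section \<open>Excursions from a bulk state\<close>

text \<open>Each of the two laws differs from the point mass at \<open>a\<close>, on any event, by
  at most the mass it puts elsewhere. The lower bound tests the event \<open>{a}\<close>.\<close>

lemma tv_dist_near_point_mass:
  fixes \<mu> \<nu> :: "'s pmf"
  assumes "finite S" "a \<in> S"
  shows "tv_dist S \<mu> \<nu> \<le> (1 - pmf \<mu> a) + (1 - pmf \<nu> a)"
    and "pmf \<nu> a - pmf \<mu> a \<le> tv_dist S \<mu> \<nu>"
proof -
  have "\<bar>measure_pmf.prob \<mu> A - measure_pmf.prob \<nu> A\<bar> \<le> (1 - pmf \<mu> a) + (1 - pmf \<nu> a)" for A
  proof -
    have in_A: "pmf \<kappa> a \<le> measure_pmf.prob \<kappa> A" if "a \<in> A" for \<kappa> :: "'s pmf"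
      using that by (subst measure_pmf_single[symmetric])
        (intro measure_pmf.finite_measure_mono, auto)
    have notin_A: "measure_pmf.prob \<kappa> A \<le> 1 - pmf \<kappa> a" if "a \<notin> A" for \<kappa> :: "'s pmf"
    proof -
      have "measure_pmf.prob \<kappa> A \<le> measure_pmf.prob \<kappa> (UNIV - {a})"
        using that by (intro measure_pmf.finite_measure_mono) auto
      also have "\<dots> = 1 - pmf \<kappa> a"
        using measure_pmf.prob_compl[of "{a}" \<kappa>] by (simp add: measure_pmf_single)
      finally show ?thesis .
    qed
    show ?thesis
    proof (cases "a \<in> A")
      case True
      then show ?thesis
        using in_A[of \<mu>] in_A[of \<nu>] measure_pmf.prob_le_1[of \<mu> A] measure_pmf.prob_le_1[of \<nu> A]
        by linarith
    next
      case False
      then show ?thesis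
        using notin_A[of \<mu>] notin_A[of \<nu>] measure_nonneg[of \<mu> A] measure_nonneg[of \<nu> A]
        by linarith
    qed
  qed
  then show "tv_dist S \<mu> \<nu> \<le> (1 - pmf \<mu> a) + (1 - pmf \<nu> a)"
    unfolding tv_dist_def using assms by (subst Max_le_iff) auto
  have "pmf \<nu> a - pmf \<mu> a \<le> \<bar>measure_pmf.prob \<mu> {a} - measure_pmf.prob \<nu> {a}\<bar>"
    by (simp add: measure_pmf_single)
  also have "\<dots> \<le> tv_dist S \<mu> \<nu>"
    unfolding tv_dist_def using assms by (intro Max_ge) auto
  finally show "pmf \<nu> a - pmf \<mu> a \<le> tv_dist S \<mu> \<nu>" .
qed

text \<open>
  The state \<open>k < N\<close> counts the steps since the last visit to the bulk state \<open>N\<close>, and \<open>s k\<close> is the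
  probability that an excursion from \<open>N\<close> lasts more than \<open>k\<close> steps. An excursion starts with the
  small probability \<open>\<epsilon>\<close> only, so that the stationary distribution is almost the point mass at \<open>N\<close>.
\<close>

locale excursion_chain =
  fixes N :: nat and s :: "nat \<Rightarrow> real" and \<epsilon> :: real
  assumes N_pos: "N > 0" and s_0: "s 0 = 1" and s_antimono: "antimono s"
    and s_pos: "k < N \<Longrightarrow> s k > 0" and s_zero: "k \<ge> N \<Longrightarrow> s k = 0"
    and eps: "0 < \<epsilon>" "\<epsilon> \<le> 1"
begin

text \<open>The quotient is the conditional probability that an excursion lasting more than
  \<open>x\<close> steps lasts more than \<open>Suc x\<close>. It is 0 at \<open>x = N - 1\<close>,
  so the walk is then forced into the bulk.\<close>

definition kernel :: "nat \<Rightarrow> nat pmf" where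
  "kernel x = (if x < N
     then map_pmf (\<lambda>b. if b then Suc x else N) (bernoulli_pmf (s (Suc x) / s x))
     else map_pmf (\<lambda>b. if b then 0 else N) (bernoulli_pmf \<epsilon>))"

lemma s_nonneg: "s k \<ge> 0"
  using s_pos[of k] s_zero[of k] by (cases "k < N") (auto intro: less_imp_le)

lemma ratio_bounds: "0 \<le> s (Suc x) / s x" "s (Suc x) / s x \<le> 1"
  using s_nonneg[of x] s_nonneg[of "Suc x"] antimonoD[OF s_antimono, of x "Suc x"]
  by (auto intro!: divide_le_eq_1[THEN iffD2] simp: less_le)

lemma set_kernel: "x \<in> {..N} \<Longrightarrow> set_pmf (kernel x) \<subseteq> {..N}"
  by (auto simp: kernel_def)

lemma pmf_map_bernoulli:
  "0 \<le> q \<Longrightarrow> q \<le> 1 \<Longrightarrow> pmf (map_pmf (\<lambda>b. if b then u else v) (bernoulli_pmf q)) y =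
    q * indicator {u} y + (1 - q) * indicator {v} y"
  unfolding map_pmf_def pmf_bind by (auto simp: pmf_return indicator_def)

lemma pmf_bind_kernel:
  "x < N \<Longrightarrow> pmf (bind_pmf (kernel x) f) y =
    s (Suc x) / s x * pmf (f (Suc x)) y + (1 - s (Suc x) / s x) * pmf (f N) y"
  "pmf (bind_pmf (kernel N) f) y = \<epsilon> * pmf (f 0) y + (1 - \<epsilon>) * pmf (f N) y"
  using ratio_bounds[of x] eps by (simp_all add: kernel_def bind_map_pmf pmf_bind)

text \<open>First-step analysis. Without departures from the bulk the quotient would be the exact
  probability of being outside it; each of the \<open>j\<close> steps adds at most \<epsilon> for
  such a departure. For \<open>x = N\<close> division by 0 gives the quotient 0, which is the right
  value.\<close>

lemma not_absorbed_bounds: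
  "x \<le> N \<Longrightarrow> s (x + j) / s x \<le> 1 - pmf (kernel_power kernel j x) N \<and>
    1 - pmf (kernel_power kernel j x) N \<le> s (x + j) / s x + real j * \<epsilon>"
proof (induction j arbitrary: x)
  case 0
  have "s x / s x = 1 - indicator {N} x"
    using s_pos[of x] s_zero[of x] 0 by (cases "x = N") auto
  then show ?case using eps by (auto simp: pmf_return indicator_def)
next
  case (Suc j)
  define f where "f y = 1 - pmf (kernel_power kernel j y) N" for y
  have fN: "f N \<ge> 0" "f N \<le> real j * \<epsilon>"
    using Suc.IH[of N] s_zero[of "N + j"] s_zero[of N] by (simp_all add: f_def)
  show ?case
  proof (cases "x < N")
    case True
    define q where "q = s (Suc x) / s x"
    have q: "0 \<le> q" "q \<le> 1" using ratio_bounds[of x] by (simp_all add: q_def)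
    have step: "1 - pmf (kernel_power kernel (Suc j) x) N = q * f (Suc x) + (1 - q) * f N"
      using True by (simp add: pmf_bind_kernel q_def f_def algebra_simps)
    \<comment> \<open>If \<open>s (Suc x) = 0\<close> the fraction does not cancel, but by
      monotonicity both sides of \<open>qs\<close> are 0.\<close>
    have "s (Suc x) = 0 \<Longrightarrow> s (x + Suc j) = 0"
      using antimonoD[OF s_antimono, of "Suc x" "x + Suc j"] s_nonneg[of "x + Suc j"] by simp
    then have qs: "q * (s (Suc x + j) / s (Suc x)) = s (x + Suc j) / s x"
      by (cases "s (Suc x) = 0") (auto simp: q_def)
    have IH: "s (Suc x + j) / s (Suc x) \<le> f (Suc x)"
      "f (Suc x) \<le> s (Suc x + j) / s (Suc x) + real j * \<epsilon>"
      using Suc.IH[of "Suc x"] True by (simp_all add: f_def)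
    have "s (x + Suc j) / s x \<le> q * f (Suc x) + (1 - q) * f N"
      using mult_left_mono[OF IH(1) q(1)] mult_nonneg_nonneg[of "1 - q" "f N"] q(2) fN(1)
      unfolding qs by linarith
    moreover have "q * f (Suc x) + (1 - q) * f N \<le> s (x + Suc j) / s x + real (Suc j) * \<epsilon>"
    proof -
      have "q * f (Suc x) \<le> s (x + Suc j) / s x + q * (real j * \<epsilon>)"
        using mult_left_mono[OF IH(2) q(1)] by (simp only: distrib_left qs)
      moreover have "(1 - q) * f N \<le> (1 - q) * (real j * \<epsilon>)"
        using fN q by (intro mult_left_mono) auto
      ultimately show ?thesis using eps by (simp add: algebra_simps)
    qed
    ultimately show ?thesis by (simp only: step)
  next
    case False
    then have x: "x = N" using Suc.prems by simp
    have step: "1 - pmf (kernel_power kernel (Suc j) x) N = \<epsilon> * f 0 + (1 - \<epsilon>) * f N"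
      by (simp add: x pmf_bind_kernel f_def algebra_simps)
    have f0: "0 \<le> f 0" "f 0 \<le> 1" by (simp_all add: f_def pmf_le_1)
    have "\<epsilon> * f 0 \<le> \<epsilon>" using f0 eps by (simp add: mult_left_le)
    moreover have "(1 - \<epsilon>) * f N \<le> 1 * f N"
      using fN eps by (intro mult_right_mono) auto
    moreover have "0 \<le> \<epsilon> * f 0" "0 \<le> (1 - \<epsilon>) * f N" using f0 fN eps by simp_all
    moreover have "s (x + Suc j) / s x = 0" "real (Suc j) * \<epsilon> = real j * \<epsilon> + \<epsilon>"
      by (simp_all add: x s_zero algebra_simps)
    ultimately show ?thesis
      unfolding step using fN by linarith
  qed
qed

text \<open>All states communicate through \<open>N\<close>. A state below \<open>N\<close> either
  can fall into \<open>N\<close> at once or moves up surely, which induction on \<open>N - x\<close>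
  handles; from \<open>N\<close> the walk restarts at 0 and climbs with positive
  probability.\<close>

lemma kernel_irreducible:
  assumes "x \<le> N" "y \<le> N"
  shows "\<exists>j. pmf (kernel_power kernel j x) y > 0"
proof -
  have to_N: "\<exists>j. pmf (kernel_power kernel j x) N > 0" if "x \<le> N" for x
    using that
  proof (induction "N - x" arbitrary: x)
    case 0
    then show ?case by (intro exI[of _ 0]) simp
  next
    case (Suc d)
    show ?case
    proof (cases "s (Suc x) / s x = 1")
      case True
      have "d = N - Suc x" "Suc x \<le> N" using Suc.hyps(2) by simp_all
      then obtain j where "pmf (kernel_power kernel j (Suc x)) N > 0" using Suc.hyps(1) by blast
      then show ?thesis using Suc.hyps(2) True
        by (intro exI[of _ "Suc j"]) (simp add: pmf_bind_kernel)
    next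
      case False
      have "0 < 1 - s (Suc x) / s x" using False ratio_bounds(2)[of x] by linarith
      also have "\<dots> \<le> pmf (kernel_power kernel (Suc 0) x) N"
        using Suc.hyps(2) ratio_bounds(1)[of x] by (simp add: pmf_bind_kernel s_nonneg)
      finally show ?thesis by blast
    qed
  qed
  have from_N: "pmf (kernel_power kernel (Suc y) N) y > 0" if "y < N" for y
  proof -
    have "pmf (kernel_power kernel y 0) y > 0" if "y < N" for y
      using that
    proof (induction y)
      case (Suc y)
      have "0 < s (Suc y) / s y" using Suc.prems s_pos[of y] s_pos[of "Suc y"] by simp
      also have "\<dots> = pmf (kernel y) (Suc y)"
        using Suc.prems ratio_bounds[of y] by (simp add: kernel_def pmf_map_bernoulli)
      finally have "0 < pmf (kernel_power kernel y 0) y * pmf (kernel y) (Suc y)"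
        using Suc by (intro mult_pos_pos) auto
      also have "\<dots> \<le> pmf (bind_pmf (kernel_power kernel y 0) kernel) (Suc y)"
        by (rule pmf_bind_ge)
      \<comment> \<open>\<open>kernel_power\<close> peels off the first step, whereas the climb
        appends a last one.\<close>
      also have "bind_pmf (kernel_power kernel y 0) kernel = kernel_power kernel (Suc y) 0"
      proof -
        have "kernel_power kernel 0 = return_pmf" by (rule ext) simp
        then have "kernel_power kernel 1 = kernel" by (intro ext) (simp add: bind_return_pmf')
        then show ?thesis using kernel_power_add[of kernel y 0 1] by simp
      qed
      finally show ?case .
    qed simp
    then show ?thesis using that eps
      by (simp add: pmf_bind_kernel add_pos_nonneg)
  qed
  obtain i where i: "pmf (kernel_power kernel i x) N > 0" using to_N assms by blast
  show ?thesis
  proof (cases "y = N")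
    case False
    have "0 < pmf (kernel_power kernel i x) N * pmf (kernel_power kernel (Suc y) N) y"
      using i from_N[of y] False assms by (intro mult_pos_pos) auto
    also have "\<dots> \<le> pmf (kernel_power kernel (i + Suc y) x) y"
      unfolding kernel_power_add[symmetric] by (rule pmf_bind_ge)
    finally show ?thesis by blast
  qed (use i in blast)
qed

section \<open>The stationary distribution of the excursion chain\<close>

definition total :: real where "total = 1 + \<epsilon> * (\<Sum>k<N. s k)"

text \<open>The cycle formula: \<open>\<epsilon> * s k\<close> is the expected number of visits to
  \<open>k < N\<close> between two consecutive visits to \<open>N\<close>.\<close>

definition weight :: "nat \<Rightarrow> real" where
  "weight k = (if k = N then 1 else \<epsilon> * s k) / total"

definition stationary :: "nat pmf" where "stationary = embed_pmf weight"

lemma total_bounds: "1 \<le> total" "total \<le> 1 + real N * \<epsilon>"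
proof -
  have "(\<Sum>k<N. s k) \<le> (\<Sum>k<N. 1)"
    using antimonoD[OF s_antimono, of 0] s_0 by (intro sum_mono) auto
  then show "total \<le> 1 + real N * \<epsilon>" using eps by (simp add: total_def)
  show "1 \<le> total" using eps by (simp add: total_def sum_nonneg s_nonneg)
qed

lemma pmf_stationary: "pmf stationary k = weight k"
  unfolding stationary_def
proof (rule pmf_embed_pmf)
  show nonneg: "weight k \<ge> 0" for k
    using total_bounds eps s_nonneg by (simp add: weight_def)
  have "(\<integral>\<^sup>+k. ennreal (weight k) \<partial>count_space UNIV) = (\<Sum>k\<le>N. ennreal (weight k))"
    by (rule nn_integral_count_space'[of "{..N}"]) (auto simp: weight_def s_zero)
  also have "\<dots> = ennreal (\<Sum>k\<le>N. weight k)"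
    by (intro sum_ennreal nonneg)
  also have "(\<Sum>k\<le>N. weight k) = 1"
    using total_bounds
    by (simp add: lessThan_Suc_atMost[symmetric] weight_def total_def
        sum_divide_distrib[symmetric] sum_distrib_left[symmetric] add_divide_distrib[symmetric])
  finally show "(\<integral>\<^sup>+k. ennreal (weight k) \<partial>count_space UNIV) = 1" by simp
qed

lemma set_stationary: "set_pmf stationary \<subseteq> {..N}"
proof
  fix k assume "k \<in> set_pmf stationary"
  then show "k \<in> {..N}"
    using s_zero[of k] by (cases "k \<le> N") (auto simp: set_pmf_iff pmf_stationary weight_def)
qed

lemma stationary_bulk: "1 - pmf stationary N \<le> real N * \<epsilon>"
proof -
  have "1 - 1 / total = (total - 1) / total" using total_bounds by (simp add: field_simps)
  also have "\<dots> \<le> (total - 1) / 1" using total_bounds by (intro divide_left_mono) auto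
  finally show ?thesis using total_bounds by (simp add: pmf_stationary weight_def)
qed

text \<open>The flow from \<open>x\<close> to \<open>Suc x\<close> is
  \<open>\<epsilon> * s (Suc x) / total\<close>, already the weight of \<open>Suc x\<close> when
  that is below \<open>N\<close>. The flows from below into \<open>N\<close> telescope to
  \<open>\<epsilon> / total\<close>, which balances the flow from \<open>N\<close> to 0.\<close>

lemma bind_stationary: "bind_pmf stationary kernel = stationary"
proof (rule pmf_eqI)
  fix y
  have flow: "weight x * (s (Suc x) / s x) = \<epsilon> * s (Suc x) / total" if "x < N" for x
    using that s_pos[of x] by (simp add: weight_def)
  have "pmf (bind_pmf stationary kernel) y = (\<Sum>x\<in>{..N}. pmf (kernel x) y * weight x)"
    unfolding pmf_bind using set_stationary
    by (subst integral_measure_pmf_real[of "{..N}"]) (auto simp: pmf_stationary)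
  also have "\<dots> = weight N * pmf (kernel N) y + (\<Sum>x<N. weight x * pmf (kernel x) y)"
    by (simp add: lessThan_Suc_atMost[symmetric] mult.commute)
  also have "(\<Sum>x<N. weight x * pmf (kernel x) y) =
      (\<Sum>x<N. \<epsilon> * s (Suc x) / total * indicator {Suc x} y +
        (\<epsilon> * s x / total - \<epsilon> * s (Suc x) / total) * indicator {N} y)"
  proof (intro sum.cong refl)
    fix x assume "x \<in> {..<N}"
    then have x: "x < N" by simp
    then have "pmf (kernel x) y = s (Suc x) / s x * indicator {Suc x} y +
        (1 - s (Suc x) / s x) * indicator {N} y"
      using ratio_bounds[of x] by (simp add: kernel_def pmf_map_bernoulli)
    then have "weight x * pmf (kernel x) y = weight x * (s (Suc x) / s x) * indicator {Suc x} y +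
        (weight x - weight x * (s (Suc x) / s x)) * indicator {N} y"
      by (simp only:) (simp add: algebra_simps)
    then show "weight x * pmf (kernel x) y = \<epsilon> * s (Suc x) / total * indicator {Suc x} y +
        (\<epsilon> * s x / total - \<epsilon> * s (Suc x) / total) * indicator {N} y"
      unfolding flow[OF x] using x by (simp add: weight_def)
  qed
  also have "\<dots> = (\<Sum>x<N. \<epsilon> * s (Suc x) / total * indicator {Suc x} y) + \<epsilon> / total * indicator {N} y"
  proof -
    have "(\<Sum>x<N. \<epsilon> * s x / total - \<epsilon> * s (Suc x) / total) = \<epsilon> / total"
      by (subst sum_lessThan_telescope') (simp add: s_0 s_zero)
    then show ?thesis by (simp add: sum.distrib sum_distrib_right[symmetric])
  qed
  also have "weight N * pmf (kernel N) y = \<epsilon> / total * indicator {0} y + (1 - \<epsilon>) / total * indicator {N} y"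
    using eps by (simp add: kernel_def pmf_map_bernoulli weight_def add_divide_distrib)
  also have "(\<Sum>x<N. \<epsilon> * s (Suc x) / total * indicator {Suc x} y) =
      (if y = 0 then 0 else \<epsilon> * s y / total)"
  proof (cases y)
    case (Suc z)
    have "(\<Sum>x<N. \<epsilon> * s (Suc x) / total * indicator {Suc x} y) =
        (\<Sum>x<N. if x = z then \<epsilon> * s y / total else 0)"
      by (intro sum.cong) (auto simp: Suc)
    then show ?thesis using s_zero[of y] by (simp add: Suc)
  qed simp
  finally show "pmf (bind_pmf stationary kernel) y = pmf stationary y"
    using N_pos s_zero[of y]
    by (auto simp: pmf_stationary weight_def s_0 indicator_def add_divide_distrib[symmetric])
qed

section \<open>Bounds on the distance to stationarity\<close>

sublocale transition_semigroup "{..N}" "poissonized kernel"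
  by (intro transition_semigroup_poissonized set_kernel) auto

lemma ergodic_chain_excursions: "ergodic_chain {..N} path_measure (\<lambda>t \<omega>. \<omega> t)"
  using ergodic_chain_poissonized[OF transition_semigroup_axioms] kernel_irreducible by simp

lemma stationary_distribution_excursions: "stationary_distribution {..N} path_measure (\<lambda>t \<omega>. \<omega> t) stationary"
  by (intro stationary_distribution_poissonized transition_semigroup_axioms set_stationary
      bind_stationary)

lemma dist_to_stationarity_eq:
  assumes "r \<ge> 0"
  shows "dist_to_stationarity {..N} path_measure (\<lambda>t \<omega>. \<omega> t) stationary r =
    Max ((\<lambda>x. tv_dist {..N} (poissonized kernel r x) stationary) ` {..N})"
proof -
  have "tv_dist {..N} (law_at {..N} path_measure (\<lambda>t \<omega>. \<omega> t) x r) stationary =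
      tv_dist {..N} (poissonized kernel r x) stationary" if "x \<in> {..N}" for x
    unfolding tv_dist_def using that assms
    by (intro arg_cong[where f=Max] image_cong refl) (auto simp: law_at_path_measure)
  then show ?thesis
    unfolding dist_to_stationarity_def by (intro arg_cong[where f=Max] image_cong refl) auto
qed

text \<open>The three errors come from departures from the bulk within at most \<open>r + a\<close>
  steps, from the Poisson deviation, and from the stationary mass outside the bulk.\<close>

lemma dist_to_stationarity_le:
  assumes "r \<ge> 0" "a > 0" "0 \<le> u"
    and u: "\<And>x j. x \<le> N \<Longrightarrow> \<bar>real j - r\<bar> < a \<Longrightarrow> s (x + j) / s x \<le> u"
  shows "dist_to_stationarity {..N} path_measure (\<lambda>t \<omega>. \<omega> t) stationary r \<le>
    u + (r + a) * \<epsilon> + r / a\<^sup>2 + real N * \<epsilon>"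
proof -
  have "tv_dist {..N} (poissonized kernel r x) stationary \<le>
      u + (r + a) * \<epsilon> + r / a\<^sup>2 + real N * \<epsilon>" if x: "x \<le> N" for x
  proof -
    have "1 - (u + (r + a) * \<epsilon>) - r / a\<^sup>2 \<le> pmf (poissonized kernel r x) N"
    proof (rule pmf_poissonized_bounds(1))
      fix j assume j: "\<bar>real j - r\<bar> < a"
      then have "real j * \<epsilon> \<le> (r + a) * \<epsilon>" using eps by (intro mult_right_mono) auto
      then show "1 - (u + (r + a) * \<epsilon>) \<le> pmf (kernel_power kernel j x) N"
        using not_absorbed_bounds[OF x, of j] u[OF x j] by linarith
    next
      have "0 \<le> (r + a) * \<epsilon>" using assms eps by simp
      then show "1 - (u + (r + a) * \<epsilon>) \<le> 1" using assms by linarith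
    qed (use assms in auto)
    then show ?thesis
      using tv_dist_near_point_mass(1)[of "{..N}" N "poissonized kernel r x" stationary]
        stationary_bulk by auto
  qed
  then show ?thesis
    unfolding dist_to_stationarity_eq[OF assms(1)] by (subst Max_le_iff) auto
qed

text \<open>The start 0 is enough for a lower bound. Departures from the bulk only raise the chance
  of being outside it, so they cost nothing here.\<close>

lemma dist_to_stationarity_ge:
  assumes "r \<ge> 0" "a > 0" "l \<le> 1" and l: "\<And>j. \<bar>real j - r\<bar> < a \<Longrightarrow> l \<le> s j"
  shows "l - r / a\<^sup>2 - real N * \<epsilon> \<le>
    dist_to_stationarity {..N} path_measure (\<lambda>t \<omega>. \<omega> t) stationary r"
proof -
  have "pmf (poissonized kernel r 0) N \<le> (1 - l) + r / a\<^sup>2"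
  proof (rule pmf_poissonized_bounds(2))
    fix j assume "\<bar>real j - r\<bar> < a"
    then show "pmf (kernel_power kernel j 0) N \<le> 1 - l"
      using not_absorbed_bounds[of 0 j] l[of j] by (simp add: s_0)
  qed (use assms in auto)
  then have "l - r / a\<^sup>2 - real N * \<epsilon> \<le> pmf stationary N - pmf (poissonized kernel r 0) N"
    using stationary_bulk by simp
  also have "\<dots> \<le> tv_dist {..N} (poissonized kernel r 0) stationary"
    by (intro tv_dist_near_point_mass) auto
  also have "\<dots> \<le> Max ((\<lambda>x. tv_dist {..N} (poissonized kernel r x) stationary) ` {..N})"
    by (intro Max_ge) auto
  finally show ?thesis by (simp only: dist_to_stationarity_eq[OF assms(1)])
qed

end

section \<open>The cutoff profile\<close>

text \<open>
  The window around \<open>t\<close> is cut off at \<open>t \<plusminus> sqrt (t * w)\<close>: seen from \<open>t\<close> on the scale \<open>w\<close> this is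
  infinitely wide, but it is negligible compared to \<open>t\<close>, so that no state is worse than the state 0.
  The lower bound \<open>\<eta>\<close> keeps the chain irreducible where \<open>p\<close> vanishes.
\<close>

definition excursion_length :: "real \<Rightarrow> real \<Rightarrow> nat" where
  "excursion_length t w = nat \<lceil>t + sqrt (t * w)\<rceil>"

text \<open>The clause \<open>k = 0\<close> gives the value 1 at 0 even when
  \<open>w \<ge> t\<close>, which may happen for small \<open>n\<close>, where an ergodic chain is
  still demanded.\<close>

definition excursion_tail :: "(real \<Rightarrow> real) \<Rightarrow> real \<Rightarrow> real \<Rightarrow> real \<Rightarrow> nat \<Rightarrow> real" where
  "excursion_tail p \<eta> t w k =
     (if k \<ge> excursion_length t w then 0
      else if k = 0 \<or> real k < t - sqrt (t * w) then 1
      else max (p ((real k - t) / w)) \<eta>)"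

text \<open>Quadratic, because this probability times the excursion length has to vanish: that
  product bounds both the stationary mass outside the bulk and the effect of departures.\<close>

definition return_prob :: "real \<Rightarrow> real \<Rightarrow> real" where
  "return_prob t w = 1 / (real (excursion_length t w) + 1)\<^sup>2"

lemma excursion_length_ge: "t + sqrt (t * w) \<le> real (excursion_length t w)"
  unfolding excursion_length_def by linarith

lemma excursion_length_less: "t > 0 \<Longrightarrow> w > 0 \<Longrightarrow> real (excursion_length t w) < t + sqrt (t * w) + 1"
  using real_sqrt_ge_zero[of "t * w"] unfolding excursion_length_def
  by (simp add: add_pos_nonneg) linarith

lemma excursion_chain_tail:
  assumes "t > 0" "w > 0" "0 < \<eta>" "\<eta> \<le> 1" "antimono p" and p: "\<And>c. p c \<le> 1"
  shows "excursion_chain (excursion_length t w) (excursion_tail p \<eta> t w) (return_prob t w)"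
proof
  have "0 < t + sqrt (t * w)" using assms by (simp add: add_pos_nonneg)
  then show "0 < excursion_length t w" using excursion_length_ge[of t w] by linarith
  then show "excursion_tail p \<eta> t w 0 = 1" by (simp add: excursion_tail_def)
  show "antimono (excursion_tail p \<eta> t w)"
  proof (rule antimonoI)
    fix k l :: nat assume "k \<le> l"
    then have "(real k - t) / w \<le> (real l - t) / w" using assms by (simp add: divide_right_mono)
    then have "p ((real l - t) / w) \<le> p ((real k - t) / w)" by (rule antimonoD[OF assms(5)])
    then show "excursion_tail p \<eta> t w l \<le> excursion_tail p \<eta> t w k"
      using \<open>k \<le> l\<close> assms p by (auto simp: excursion_tail_def)
  qed
  show "0 < return_prob t w" "return_prob t w \<le> 1"
    by (auto simp: return_prob_def divide_le_eq_1 intro!: one_le_power)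
qed (use assms in \<open>auto simp: excursion_tail_def\<close>)

text \<open>The quotient of \<open>a * w\<close> by \<open>sqrt (t * w)\<close> is
  \<open>a * sqrt (w / t)\<close>, which tends to 0.\<close>

lemma eventually_window:
  assumes "a > 0" and "(\<lambda>n. w n / t n) \<longlonglongrightarrow> 0" and "eventually (\<lambda>n. t n > 0 \<and> w n > 0) sequentially"
  shows "eventually (\<lambda>n. \<bar>a * w n\<bar> \<le> sqrt (t n * w n)) sequentially"
proof -
  have "(\<lambda>n. a * sqrt (w n / t n)) \<longlonglongrightarrow> a * sqrt 0"
    by (intro tendsto_intros assms)
  then have "eventually (\<lambda>n. a * sqrt (w n / t n) < 1) sequentially"
    by (rule order_tendstoD) simp
  with assms(3) show ?thesis
  proof eventually_elim
    case (elim n)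
    have "a * w n = a * sqrt (w n / t n) * sqrt (t n * w n)"
      using elim by (simp add: real_sqrt_divide real_sqrt_mult)
    also have "\<dots> \<le> 1 * sqrt (t n * w n)" using elim by (intro mult_right_mono) auto
    finally show ?case using elim assms(1) by simp
  qed
qed

lemma excursion_chain_cutoff_profile:
  fixes t w \<eta> :: "nat \<Rightarrow> real" and p :: "real \<Rightarrow> real"
  defines "N \<equiv> \<lambda>n. excursion_length (t n) (w n)"
    and "K \<equiv> \<lambda>n. excursion_chain.kernel (excursion_length (t n) (w n))
          (excursion_tail p (\<eta> n) (t n) (w n)) (return_prob (t n) (w n))"
    and "\<pi> \<equiv> \<lambda>n. excursion_chain.stationary (excursion_length (t n) (w n))
          (excursion_tail p (\<eta> n) (t n) (w n)) (return_prob (t n) (w n))"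
  assumes pos: "\<And>n. n \<ge> 1 \<Longrightarrow> t n > 0 \<and> w n > 0"
    and \<eta>: "\<And>n. 0 < \<eta> n \<and> \<eta> n \<le> 1" "\<eta> \<longlonglongrightarrow> 0"
    and tw: "(\<lambda>n. sqrt (t n) / w n) \<longlonglongrightarrow> 0" and wt: "(\<lambda>n. w n / t n) \<longlonglongrightarrow> 0"
    and p: "\<And>c. p c \<in> {0..1}" "antimono p" "continuous_on UNIV p"
  shows "(\<lambda>n. dist_to_stationarity {..N n}
      (transition_semigroup.path_measure {..N n} (poissonized (K n))) (\<lambda>t \<omega>. \<omega> t) (\<pi> n)
      (t n + c * w n)) \<longlonglongrightarrow> p c" (is "?d \<longlonglongrightarrow> _")
proof -
  have ev_pos: "eventually (\<lambda>n. t n > 0 \<and> w n > 0) sequentially"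
    using pos eventually_sequentially by blast
  have tw2: "(\<lambda>n. t n / (w n)\<^sup>2) \<longlonglongrightarrow> 0"
  proof -
    have "(\<lambda>n. (sqrt (t n) / w n)\<^sup>2) \<longlonglongrightarrow> 0\<^sup>2" by (intro tendsto_intros tw)
    moreover have "eventually (\<lambda>n. (sqrt (t n) / w n)\<^sup>2 = t n / (w n)\<^sup>2) sequentially"
      using ev_pos by eventually_elim (simp add: power_divide)
    ultimately show ?thesis by (simp add: tendsto_cong)
  qed
  \<comment> \<open>The two rate assumptions together force \<open>w\<close>, and then
    \<open>t\<close>, to infinity.\<close>
  have inv_w: "(\<lambda>n. 1 / w n) \<longlonglongrightarrow> 0"
  proof -
    have "(\<lambda>n. w n / t n * (t n / (w n)\<^sup>2)) \<longlonglongrightarrow> 0 * 0" by (intro tendsto_intros wt tw2)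
    moreover have "eventually (\<lambda>n. w n / t n * (t n / (w n)\<^sup>2) = 1 / w n) sequentially"
      using ev_pos by eventually_elim (simp add: power2_eq_square)
    ultimately show ?thesis by (simp add: tendsto_cong)
  qed
  have inv_t: "(\<lambda>n. 1 / t n) \<longlonglongrightarrow> 0"
  proof -
    have "(\<lambda>n. w n / t n * (1 / w n)) \<longlonglongrightarrow> 0 * 0" by (intro tendsto_intros wt inv_w)
    moreover have "eventually (\<lambda>n. w n / t n * (1 / w n) = 1 / t n) sequentially"
      using ev_pos by eventually_elim simp
    ultimately show ?thesis by (simp add: tendsto_cong)
  qed
  \<comment> \<open>The Chebyshev term for a deviation of \<open>\<delta> * w\<close>, and one
    \<open>1 / t\<close> each for departures from the bulk and for the stationary mass outside
    it.\<close>
  define err where "err \<delta> n = (t n + c * w n) / (\<delta> * w n)\<^sup>2 + 2 * (1 / t n)" for \<delta> n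
  have err: "err \<delta> \<longlonglongrightarrow> 0" if "\<delta> > 0" for \<delta>
  proof -
    have "(\<lambda>n. (t n / (w n)\<^sup>2 + c * (1 / w n)) / \<delta>\<^sup>2 + 2 * (1 / t n)) \<longlonglongrightarrow> (0 + c * 0) / \<delta>\<^sup>2 + 2 * 0"
      using that by (intro tendsto_intros tw2 inv_w inv_t) auto
    moreover have "eventually (\<lambda>n. (t n / (w n)\<^sup>2 + c * (1 / w n)) / \<delta>\<^sup>2 + 2 * (1 / t n) = err \<delta> n) sequentially"
      using ev_pos
    proof eventually_elim
      case (elim n)
      then show ?case
        using that by (simp add: err_def power_mult_distrib power2_eq_square field_simps)
    qed
    ultimately show ?thesis by (simp add: tendsto_cong)
  qed
  have bounds: "eventually (\<lambda>n. p (c + \<delta>) - err \<delta> n \<le> ?d n \<and> ?d n \<le> max (p (c - \<delta>)) (\<eta> n) + err \<delta> n)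
      sequentially" if \<delta>: "\<delta> > 0" for \<delta>
  proof -
    define b where "b = \<bar>c\<bar> + \<delta>"
    have "b > 0" using \<delta> by (simp add: b_def)
    have "(\<lambda>n. 2 * sqrt (w n / t n) + 1 / t n + b * (w n / t n)) \<longlonglongrightarrow> 2 * sqrt 0 + 0 + b * 0"
      by (intro tendsto_intros wt inv_t)
    then have "eventually (\<lambda>n. 2 * sqrt (w n / t n) + 1 / t n + b * (w n / t n) < 1) sequentially"
      by (rule order_tendstoD) simp
    with ev_pos eventually_window[OF \<open>b > 0\<close> wt ev_pos] eventually_ge_at_top[of 1] show ?thesis
    proof eventually_elim
      case (elim n)
      define T W L s e where "T = t n" and "W = w n" and "L = sqrt (T * W)"
        and "s = excursion_tail p (\<eta> n) T W" and "e = return_prob T W"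
      define r a where "r = T + c * W" and "a = \<delta> * W"
      have TW: "T > 0" "W > 0" using elim by (simp_all add: T_def W_def)
      have a: "a > 0" using TW \<delta> by (simp add: a_def)
      have bW: "b * W \<le> L" using elim \<open>b > 0\<close> TW by (simp add: T_def W_def L_def)
      have cW: "- (b * W) \<le> c * W - a" "c * W + a \<le> b * W"
      proof -
        have "(- b) * W \<le> (c - \<delta>) * W" "(c + \<delta>) * W \<le> b * W"
          using TW by (intro mult_right_mono; simp add: b_def)+
        then show "- (b * W) \<le> c * W - a" "c * W + a \<le> b * W"
          by (simp_all add: a_def algebra_simps)
      qed
      \<comment> \<open>The window and the rounding have total length at most
        \<open>2 * L + 1\<close>; this leaves room for a run of at least \<open>T - b * W\<close>
        steps to cross them.\<close>
      have small: "2 * L + 1 + b * W < T"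
      proof -
        have "T * W = W / T * T\<^sup>2" using TW by (simp add: power2_eq_square)
        then have "L = sqrt (W / T) * T" using TW by (simp only: L_def real_sqrt_mult) simp
        moreover have "(2 * sqrt (W / T) + 1 / T + b * (W / T)) * T < 1 * T"
          using elim TW by (intro mult_strict_right_mono) (simp_all add: T_def W_def)
        ultimately show ?thesis using TW by (simp add: distrib_right)
      qed
      have L: "L \<ge> 0" using TW by (simp add: L_def)
      have r: "r \<ge> 0" using small cW a L by (simp add: r_def)
      have N: "T + L \<le> real (N n)" "real (N n) < T + L + 1"
        using excursion_length_ge[of T W] excursion_length_less[of T W] TW
        by (simp_all add: N_def T_def W_def L_def)
      interpret excursion_chain "N n" s e
        unfolding N_def s_def e_def T_def W_def
        using excursion_chain_tail[of "t n" "w n" "\<eta> n" p] elim \<eta>(1)[of n] p by auto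
      have d: "?d n = dist_to_stationarity {..N n} path_measure (\<lambda>t \<omega>. \<omega> t) stationary r"
        by (simp add: K_def \<pi>_def N_def s_def e_def T_def W_def r_def)
      have Ne: "real (N n) * e \<le> 1 / T"
      proof -
        have "real (N n) * e \<le> (real (N n) + 1) * e"
          using eps by (intro mult_right_mono) auto
        also have "\<dots> = 1 / (real (N n) + 1)"
          by (simp add: e_def return_prob_def N_def T_def W_def power2_eq_square)
        also have "\<dots> \<le> 1 / T" using N TW L by (intro divide_left_mono) auto
        finally show ?thesis .
      qed
      have err_eq: "err \<delta> n = r / a\<^sup>2 + 2 * (1 / T)"
        by (simp add: err_def r_def a_def T_def W_def)
      have "?d n \<le> max (p (c - \<delta>)) (\<eta> n) + (r + a) * e + r / a\<^sup>2 + real (N n) * e"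
        unfolding d
      proof (rule dist_to_stationarity_le[OF r a])
        show nonneg: "0 \<le> max (p (c - \<delta>)) (\<eta> n)" using \<eta>(1)[of n] by auto
        fix x j assume x: "x \<le> N n" and "\<bar>real j - r\<bar> < a"
        then have j: "T + c * W - a < real j" by (simp add: r_def)
        have sj: "s j \<le> max (p (c - \<delta>)) (\<eta> n)"
        proof -
          have "T - L < real j" using j cW bW by linarith
          \<comment> \<open>Excludes the clause \<open>k = 0\<close>, in which \<open>s\<close> is 1
            whatever \<open>p\<close> is.\<close>
          have "0 < j" using j cW small L bW by (cases j) auto
          have "(c - \<delta>) * W \<le> real j - T" using j by (simp add: a_def algebra_simps)
          then have "c - \<delta> \<le> (real j - T) / W" using TW by (simp only: pos_le_divide_eq)
          then have "p ((real j - T) / W) \<le> p (c - \<delta>)" by (rule antimonoD[OF p(2)])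
          then show ?thesis using \<open>T - L < real j\<close> \<open>0 < j\<close> nonneg
            by (auto simp: s_def excursion_tail_def L_def)
        qed
        show "s (x + j) / s x \<le> max (p (c - \<delta>)) (\<eta> n)"
        \<comment> \<open>Either no survival probability has been lost yet, or \<open>j\<close>
          steps from \<open>x\<close> lead past \<open>N\<close>.\<close>
        proof (cases "x < N n \<and> (x = 0 \<or> real x < T - L)")
          case True
          then have "s x = 1" by (auto simp: s_def excursion_tail_def N_def L_def T_def W_def)
          then show ?thesis using sj antimonoD[OF s_antimono, of j "x + j"] by simp
        next
          case False
          have "real (N n) \<le> real x + real j"
          proof (cases "x < N n")
            case True
            then have "T - L \<le> real x" using False by auto
            then show ?thesis using N small cW j by linarith
          qed simp
          then have "s (x + j) = 0" by (intro s_zero) linarith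
          then show ?thesis using nonneg by simp
        qed
      qed
      \<comment> \<open>\<open>r + a \<le> T + b * W \<le> T + L \<le> N n\<close>.\<close>
      moreover have "(r + a) * e \<le> real (N n) * e"
        using cW bW N eps by (intro mult_right_mono) (auto simp: r_def)
      ultimately have "?d n \<le> max (p (c - \<delta>)) (\<eta> n) + err \<delta> n"
        using Ne unfolding err_eq by linarith
      moreover have "p (c + \<delta>) - r / a\<^sup>2 - real (N n) * e \<le> ?d n"
        unfolding d
      proof (rule dist_to_stationarity_ge[OF r a])
        show "p (c + \<delta>) \<le> 1" using p(1) by auto
        fix j assume "\<bar>real j - r\<bar> < a"
        then have j: "real j < T + c * W + a" by (simp add: r_def)
        then have "j < N n" using N cW bW by linarith
        have "real j - T \<le> (c + \<delta>) * W" using j by (simp add: a_def algebra_simps)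
        then have "(real j - T) / W \<le> c + \<delta>" using TW by (simp only: pos_divide_le_eq)
        then have "p (c + \<delta>) \<le> p ((real j - T) / W)" by (rule antimonoD[OF p(2)])
        then show "p (c + \<delta>) \<le> s j"
          using \<open>j < N n\<close> p(1)[of "c + \<delta>"]
          by (auto simp: s_def excursion_tail_def N_def T_def W_def le_max_iff_disj)
      qed
      moreover have "0 \<le> 1 / T" using TW by simp
      ultimately have "p (c + \<delta>) - err \<delta> n \<le> ?d n \<and> ?d n \<le> max (p (c - \<delta>)) (\<eta> n) + err \<delta> n"
        using Ne unfolding err_eq by linarith
      then show ?case .
    qed
  qed
  show ?thesis
  proof (rule LIMSEQ_I)
    fix \<epsilon> :: real assume "\<epsilon> > 0"
    have "isCont p c" using p(3) by (simp add: continuous_on_eq_continuous_at)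
    then obtain \<delta>' where \<delta>': "\<delta>' > 0" "\<And>x. \<bar>x - c\<bar> < \<delta>' \<Longrightarrow> \<bar>p x - p c\<bar> < \<epsilon> / 2"
      using \<open>\<epsilon> > 0\<close> unfolding continuous_at_eps_delta dist_real_def
      by (metis half_gt_zero)
    define \<delta> where "\<delta> = \<delta>' / 2"
    have \<delta>: "\<delta> > 0" "\<bar>p (c + \<delta>) - p c\<bar> < \<epsilon> / 2" "\<bar>p (c - \<delta>) - p c\<bar> < \<epsilon> / 2"
      using \<delta>' by (auto simp: \<delta>_def)
    have "eventually (\<lambda>n. err \<delta> n < \<epsilon> / 2) sequentially"
      using order_tendstoD(2)[OF err[OF \<delta>(1)], of "\<epsilon> / 2"] \<open>\<epsilon> > 0\<close> by simp
    moreover have "eventually (\<lambda>n. \<eta> n < \<epsilon> / 2) sequentially"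
      using order_tendstoD(2)[OF \<eta>(2), of "\<epsilon> / 2"] \<open>\<epsilon> > 0\<close> by simp
    ultimately have "eventually (\<lambda>n. norm (?d n - p c) < \<epsilon>) sequentially"
      using bounds[OF \<delta>(1)]
    proof eventually_elim
      case (elim n)
      have "max (p (c - \<delta>)) (\<eta> n) < p c + \<epsilon> / 2"
      proof -
        have "p (c - \<delta>) < p c + \<epsilon> / 2" using \<delta>(3) unfolding abs_less_iff by linarith
        moreover have "\<eta> n < p c + \<epsilon> / 2" using elim p(1)[of c] by simp
        ultimately show ?thesis by (simp only: max_less_iff_conj)
      qed
      then show ?case using elim \<delta>(2) unfolding real_norm_def abs_less_iff by linarith
    qed
    then show "\<exists>no. \<forall>n\<ge>no. norm (?d n - p c) < \<epsilon>"
      by (simp add: eventually_sequentially)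
  qed
qed

theorem theorem1p6:
  fixes t w :: "nat \<Rightarrow> real" and p :: "real \<Rightarrow> real"
  assumes "\<And>n. n \<ge> 1 \<Longrightarrow> t n > 0"
    and "\<And>n. n \<ge> 1 \<Longrightarrow> w n > 0"
    and "(\<lambda>n. sqrt (t n) / w n) \<longlonglongrightarrow> 0"
    and "(\<lambda>n. w n / t n) \<longlonglongrightarrow> 0"
    and "\<And>c. p c \<in> {0..1}"
    and "antimono p"
    and "continuous_on UNIV p"
    and "(p \<longlongrightarrow> 1) at_bot"
    and "(p \<longlongrightarrow> 0) at_top"
  shows "\<exists>(S :: nat \<Rightarrow> nat set) (P :: nat \<Rightarrow> nat \<Rightarrow> (real \<Rightarrow> nat) measure)
            (X :: nat \<Rightarrow> real \<Rightarrow> (real \<Rightarrow> nat) \<Rightarrow> nat) (\<pi> :: nat \<Rightarrow> nat pmf).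
           (\<forall>n\<ge>1. ergodic_chain (S n) (P n) (X n) \<and>
                   stationary_distribution (S n) (P n) (X n) (\<pi> n)) \<and>
           (\<forall>c. (\<lambda>n. dist_to_stationarity (S n) (P n) (X n) (\<pi> n) (t n + c * w n)) \<longlonglongrightarrow> p c)"
proof -
  define \<eta> :: "nat \<Rightarrow> real" where "\<eta> n = 1 / real (Suc n)" for n
  have \<eta>: "0 < \<eta> n \<and> \<eta> n \<le> 1" for n by (simp add: \<eta>_def)
  have \<eta>_lim: "\<eta> \<longlonglongrightarrow> 0"
    using LIMSEQ_inverse_real_of_nat by (simp add: \<eta>_def[abs_def] inverse_eq_divide)
  let ?N = "\<lambda>n. excursion_length (t n) (w n)"
  let ?K = "\<lambda>n. excursion_chain.kernel (?N n) (excursion_tail p (\<eta> n) (t n) (w n))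
    (return_prob (t n) (w n))"
  let ?\<pi> = "\<lambda>n. excursion_chain.stationary (?N n) (excursion_tail p (\<eta> n) (t n) (w n))
    (return_prob (t n) (w n))"
  let ?P = "\<lambda>n. transition_semigroup.path_measure {..?N n} (poissonized (?K n))"
  have "ergodic_chain {..?N n} (?P n) (\<lambda>t \<omega>. \<omega> t) \<and>
      stationary_distribution {..?N n} (?P n) (\<lambda>t \<omega>. \<omega> t) (?\<pi> n)" if "n \<ge> 1" for n
  proof -
    interpret excursion_chain "?N n" "excursion_tail p (\<eta> n) (t n) (w n)" "return_prob (t n) (w n)"
      using assms(1,2)[OF that] assms(5,6) \<eta>[of n] by (intro excursion_chain_tail) auto
    show ?thesis using ergodic_chain_excursions stationary_distribution_excursions by simp
  qed
  moreover have "(\<lambda>n. dist_to_stationarity {..?N n} (?P n) (\<lambda>t \<omega>. \<omega> t) (?\<pi> n) (t n + c * w n))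
      \<longlonglongrightarrow> p c" for c
    using assms(1-7) \<eta> \<eta>_lim by (intro excursion_chain_cutoff_profile) auto
  ultimately show ?thesis
    by (intro exI[of _ "\<lambda>n. {..?N n}"] exI[of _ ?P] exI[of _ "\<lambda>n t \<omega>. \<omega> t"] exI[of _ ?\<pi>]) blast
qed

end
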